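(* Let $\beta,\gamma$ be real numbers such that $\beta+\gamma\geq 1$. Then for every graph $G$, the partition function $Z_G$ is positive.
   Context: Graphs are finite undirected multigraphs, possibly with self-loops and parallel edges. For fixed $\beta,\gamma$, let $A=\begin{bmatrix}\beta&1\\1&\gamma\end{bmatrix}$ and for a graph $G=(V,E)$ define $Z_G=\sum_{\sigma\in\{0,1\}^V}\prod_{\{u,v\}\in E}A_{\sigma(u),\sigma(v)}$. *)

theory Defs
  imports Complex_Main "HOL-Library.Multiset" "HOL-Library.FuncSet" "HOL-Library.Uprod"
begin

text \<open>A finite undirected multigraph: the edges form a multiset of unordered pairs of vertices,
  where \<open>Upair v v\<close> is a self-loop and multiplicities account for parallel edges.\<close>

definition multigraph :: "'v set \<Rightarrow> 'v uprod multiset \<Rightarrow> bool" where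
  "multigraph V E \<longleftrightarrow> finite V \<and> (\<forall>e \<in># E. set_uprod e \<subseteq> V)"

text \<open>The entries of \<open>A = [[\<beta>, 1], [1, \<gamma>]]\<close>, with rows and columns indexed by \<open>{0, 1}\<close>;
  arguments outside this set are irrelevant.\<close>

definition interaction :: "real \<Rightarrow> real \<Rightarrow> nat \<Rightarrow> nat \<Rightarrow> real" where
  "interaction \<beta> \<gamma> i j =
     (if i = 0 \<and> j = 0 then \<beta> else if i = 1 \<and> j = 1 then \<gamma> else 1)"

text \<open>Since \<open>A\<close> is symmetric, its entry at an unordered pair of indices is well defined.\<close>

lift_definition edge_weight :: "real \<Rightarrow> real \<Rightarrow> nat uprod \<Rightarrow> real" is
  "\<lambda>\<beta> \<gamma> (i, j). interaction \<beta> \<gamma> i j"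
  by (auto simp: interaction_def)

lemma edge_weight_Upair [simp]:
  "edge_weight \<beta> \<gamma> (Upair i j) = interaction \<beta> \<gamma> i j"
  by transfer simp

definition partition_function :: "real \<Rightarrow> real \<Rightarrow> 'v set \<Rightarrow> 'v uprod multiset \<Rightarrow> real" where
  "partition_function \<beta> \<gamma> V E =
     (\<Sum>\<sigma> \<in> V \<rightarrow>\<^sub>E {0, 1}. \<Prod>e \<in># E. edge_weight \<beta> \<gamma> (map_uprod \<sigma> e))"

end

theory Submission
  imports Defs
begin

text \<open>
  If \<open>\<beta>, \<gamma> > 0\<close> every summand is positive, and exchanging the two spins exchanges \<open>\<beta>\<close> and
  \<open>\<gamma>\<close>, so let \<open>\<gamma> = -g \<le> 0\<close> and \<open>\<beta> \<ge> 1 + g\<close>.  Put \<open>q = g / (1 + g)\<close> and let every vertex carry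
  an external field, a weight vector \<open>(x, y)\<close> indexed by its spin, with \<open>x > 0\<close> and
  \<open>-q x \<le> y \<le> x\<close>.  Writing \<open>Z\<^sub>0\<close>, \<open>Z\<^sub>1\<close> for the partition functions with a root \<open>r\<close> pinned to
  spin 0 and 1, the invariant is \<open>Z\<^sub>0 > 0\<close> and \<open>-q Z\<^sub>0 \<le> Z\<^sub>1 \<le> Z\<^sub>0\<close>, for all such fields and all
  roots.  The interval \<open>[-q, 1]\<close> is forced: a loop at an otherwise isolated vertex gives the ratio
  \<open>-q\<close> (when \<open>\<beta> = 1 + g\<close>), no edge at all gives the ratio 1.
  The invariant is proved by deleting an edge \<open>r w\<close>: the bilinear forms in the pinned spins of
  \<open>(r, w)\<close> that express it for the whole graph are nonnegative combinations of forms
  (root inequality) \<open>\<otimes>\<close> (field) and (field) \<open>\<otimes>\<close> (root inequality), which are nonnegative for the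
  graph without the edge.
\<close>

section \<open>External fields, pinning and multilinearity\<close>

definition field_partition_function ::
    "real \<Rightarrow> real \<Rightarrow> 'v set \<Rightarrow> 'v uprod multiset \<Rightarrow> ('v \<Rightarrow> nat \<Rightarrow> real) \<Rightarrow> real" where
  "field_partition_function \<beta> \<gamma> V E f =
     (\<Sum>\<sigma> \<in> V \<rightarrow>\<^sub>E {0, 1}. (\<Prod>v\<in>V. f v (\<sigma> v)) * (\<Prod>e \<in># E. edge_weight \<beta> \<gamma> (map_uprod \<sigma> e)))"

text \<open>Pinning is treated as a degenerate field, so that pinned and unpinned vertices are
  handled by the same sum; \<open>pin 0\<close> and \<open>pin 1\<close> form the basis in which a
  field is expanded.\<close>

definition pin :: "nat \<Rightarrow> nat \<Rightarrow> real" where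
  "pin s = (\<lambda>i. if i = s then 1 else 0)"

lemma pin_simps [simp]:
  "pin 0 0 = 1" "pin 0 (Suc 0) = 0" "pin (Suc 0) 0 = 0" "pin (Suc 0) (Suc 0) = 1"
  by (simp_all add: pin_def)

lemma partition_function_eq_field:
  "partition_function \<beta> \<gamma> V E = field_partition_function \<beta> \<gamma> V E (\<lambda>_ _. 1)"
  by (simp add: partition_function_def field_partition_function_def)

lemma field_partition_function_empty:
  assumes "finite V"
  shows "field_partition_function \<beta> \<gamma> V {#} f = (\<Prod>v\<in>V. f v 0 + f v 1)"
proof -
  have "(\<Prod>v\<in>V. f v 0 + f v 1) = (\<Prod>v\<in>V. \<Sum>i\<in>{0, 1}. f v i)"
    by simp
  also have "\<dots> = (\<Sum>\<sigma> \<in> V \<rightarrow>\<^sub>E {0, 1}. \<Prod>v\<in>V. f v (\<sigma> v))"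
    using assms by (subst prod_sum_PiE) auto
  finally show ?thesis
    by (simp add: field_partition_function_def)
qed

lemma field_partition_function_linear:
  assumes "finite V" "r \<in> V"
  shows "field_partition_function \<beta> \<gamma> V E (f(r := p)) =
    p 0 * field_partition_function \<beta> \<gamma> V E (f(r := pin 0)) +
    p 1 * field_partition_function \<beta> \<gamma> V E (f(r := pin 1))"
proof -
  have split: "(\<Prod>v\<in>V. (f(r := p')) v (\<sigma> v)) = p' (\<sigma> r) * (\<Prod>v\<in>V-{r}. f v (\<sigma> v))" for p' \<sigma>
    using assms by (subst prod.remove[of _ r]) (auto intro!: prod.cong)
  show ?thesis
    unfolding field_partition_function_def split sum_distrib_left sum.distrib[symmetric]
  proof (rule sum.cong[OF refl])
    fix \<sigma> assume "\<sigma> \<in> V \<rightarrow>\<^sub>E {0, 1::nat}"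
    then have "\<sigma> r = 0 \<or> \<sigma> r = 1" using assms by (auto dest: PiE_mem)
    then show "p (\<sigma> r) * (\<Prod>v\<in>V-{r}. f v (\<sigma> v)) * (\<Prod>e\<in>#E. edge_weight \<beta> \<gamma> (map_uprod \<sigma> e)) =
      p 0 * (pin 0 (\<sigma> r) * (\<Prod>v\<in>V-{r}. f v (\<sigma> v)) * (\<Prod>e\<in>#E. edge_weight \<beta> \<gamma> (map_uprod \<sigma> e))) +
      p 1 * (pin 1 (\<sigma> r) * (\<Prod>v\<in>V-{r}. f v (\<sigma> v)) * (\<Prod>e\<in>#E. edge_weight \<beta> \<gamma> (map_uprod \<sigma> e)))"
      by (auto simp: algebra_simps)
  qed
qed

lemma field_partition_function_bilinear:
  assumes "finite V" "u \<in> V" "w \<in> V" "u \<noteq> w"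
  shows "field_partition_function \<beta> \<gamma> V E (f(u := p, w := p')) =
    p 0 * (p' 0 * field_partition_function \<beta> \<gamma> V E (f(u := pin 0, w := pin 0)) +
           p' 1 * field_partition_function \<beta> \<gamma> V E (f(u := pin 0, w := pin 1))) +
    p 1 * (p' 0 * field_partition_function \<beta> \<gamma> V E (f(u := pin 1, w := pin 0)) +
           p' 1 * field_partition_function \<beta> \<gamma> V E (f(u := pin 1, w := pin 1)))"
  using field_partition_function_linear[OF assms(1,2), of \<beta> \<gamma> E "f(w := p')" p]
    field_partition_function_linear[OF assms(1,3), of \<beta> \<gamma> E "f(u := pin 0)" p']
    field_partition_function_linear[OF assms(1,3), of \<beta> \<gamma> E "f(u := pin 1)" p']
  by (simp add: fun_upd_twist[OF assms(4)])

text \<open>Configurations that disagree with the pins have weight zero, and on all others the edge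
  contributes the same constant factor. Loops are included.\<close>

lemma field_partition_function_pinned_edge:
  assumes "finite V" "u \<in> V" "w \<in> V" "f u = pin s" "f w = pin t"
  shows "field_partition_function \<beta> \<gamma> V (add_mset (Upair u w) E) f =
    interaction \<beta> \<gamma> s t * field_partition_function \<beta> \<gamma> V E f"
  unfolding field_partition_function_def sum_distrib_left
proof (rule sum.cong[OF refl])
  fix \<sigma> :: "'a \<Rightarrow> nat"
  show "(\<Prod>v\<in>V. f v (\<sigma> v)) * (\<Prod>e\<in>#add_mset (Upair u w) E. edge_weight \<beta> \<gamma> (map_uprod \<sigma> e)) =
    interaction \<beta> \<gamma> s t * ((\<Prod>v\<in>V. f v (\<sigma> v)) * (\<Prod>e\<in>#E. edge_weight \<beta> \<gamma> (map_uprod \<sigma> e)))"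
  proof (cases "\<sigma> u = s \<and> \<sigma> w = t")
    case True
    then show ?thesis by (simp add: algebra_simps)
  next
    case False
    then have "f u (\<sigma> u) = 0 \<or> f w (\<sigma> w) = 0" by (auto simp: assms(4,5) pin_def)
    then have "(\<Prod>v\<in>V. f v (\<sigma> v)) = 0"
      using assms(1-3) by (intro prod_zero) blast+
    then show ?thesis by simp
  qed
qed

section \<open>Symmetries under flipping spins\<close>

text \<open>Flipping the spin at \<open>r\<close> alone exchanges the two pins and changes no edge
  weight. This is the root ratio 1 of a vertex without edges.\<close>

lemma field_partition_function_isolated:
  assumes "finite V" "r \<in> V" "\<And>e. e \<in># E \<Longrightarrow> r \<notin> set_uprod e"
  shows "field_partition_function \<beta> \<gamma> V E (f(r := pin 1)) =
    field_partition_function \<beta> \<gamma> V E (f(r := pin 0))"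
proof -
  define flip where "flip \<sigma> = \<sigma>(r := 1 - \<sigma> r)" for \<sigma> :: "'a \<Rightarrow> nat"
  have PiE: "flip \<sigma> \<in> V \<rightarrow>\<^sub>E {0, 1}" if "\<sigma> \<in> V \<rightarrow>\<^sub>E {0, 1}" for \<sigma>
    using that assms(2) by (auto simp: flip_def PiE_iff extensional_def)
  have invol: "flip (flip \<sigma>) = \<sigma>" if "\<sigma> \<in> V \<rightarrow>\<^sub>E {0, 1}" for \<sigma>
  proof -
    have "\<sigma> r = 0 \<or> \<sigma> r = 1" using that assms(2) by (auto dest: PiE_mem)
    then show ?thesis by (auto simp: flip_def)
  qed
  have split: "(\<Prod>v\<in>V. (f(r := p')) v (\<sigma> v)) = p' (\<sigma> r) * (\<Prod>v\<in>V-{r}. f v (\<sigma> v))" for p' \<sigma>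
    using assms by (subst prod.remove[of _ r]) (auto intro!: prod.cong)
  show ?thesis
    unfolding field_partition_function_def split
  proof (rule sum.reindex_bij_witness[of _ flip flip], goal_cases)
    case (5 \<sigma>)
    have "\<sigma> r = 0 \<or> \<sigma> r = 1" using 5 assms(2) by (auto dest: PiE_mem)
    then have "pin 0 (flip \<sigma> r) = pin 1 (\<sigma> r)" by (auto simp: flip_def)
    moreover have "(\<Prod>v\<in>V-{r}. f v (flip \<sigma> v)) = (\<Prod>v\<in>V-{r}. f v (\<sigma> v))"
      by (rule prod.cong) (auto simp: flip_def)
    moreover have "image_mset (\<lambda>e. edge_weight \<beta> \<gamma> (map_uprod (flip \<sigma>) e)) E =
        image_mset (\<lambda>e. edge_weight \<beta> \<gamma> (map_uprod \<sigma> e)) E"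
    proof (rule image_mset_cong)
      fix e assume "e \<in># E"
      then have "map_uprod (flip \<sigma>) e = map_uprod \<sigma> e"
        using assms(3) by (intro uprod.map_cong0) (auto simp: flip_def)
      then show "edge_weight \<beta> \<gamma> (map_uprod (flip \<sigma>) e) = edge_weight \<beta> \<gamma> (map_uprod \<sigma> e)" by simp
    qed
    ultimately show ?case by simp
  qed (use PiE invol in auto)
qed

lemma partition_function_swap:
  assumes "multigraph V E"
  shows "partition_function \<beta> \<gamma> V E = partition_function \<gamma> \<beta> V E"
proof -
  define flip where "flip \<sigma> = (\<lambda>v\<in>V. 1 - \<sigma> v)" for \<sigma> :: "'a \<Rightarrow> nat"
  have PiE: "flip \<sigma> \<in> V \<rightarrow>\<^sub>E {0, 1}" if "\<sigma> \<in> V \<rightarrow>\<^sub>E {0, 1}" for \<sigma>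
    using that by (auto simp: flip_def PiE_iff extensional_def)
  have invol: "flip (flip \<sigma>) = \<sigma>" if "\<sigma> \<in> V \<rightarrow>\<^sub>E {0, 1}" for \<sigma>
  proof
    fix v show "flip (flip \<sigma>) v = \<sigma> v"
      using that by (cases "v \<in> V") (force simp: flip_def PiE_iff extensional_def)+
  qed
  show ?thesis
    unfolding partition_function_def
  proof (rule sum.reindex_bij_witness[of _ flip flip], goal_cases)
    case (5 \<sigma>)
    have "image_mset (\<lambda>e. edge_weight \<gamma> \<beta> (map_uprod (flip \<sigma>) e)) E =
        image_mset (\<lambda>e. edge_weight \<beta> \<gamma> (map_uprod \<sigma> e)) E"
    proof (rule image_mset_cong)
      fix e assume "e \<in># E"
      then have sub: "set_uprod e \<subseteq> V" using assms by (simp add: multigraph_def)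
      obtain u w where e: "e = Upair u w" by (cases e)
      have "\<sigma> u \<in> {0, 1}" "\<sigma> w \<in> {0, 1}" using 5 sub e by (auto dest: PiE_mem)
      then show "edge_weight \<gamma> \<beta> (map_uprod (flip \<sigma>) e) = edge_weight \<beta> \<gamma> (map_uprod \<sigma> e)"
        using sub e by (auto simp: flip_def interaction_def)
    qed
    then show ?case by simp
  qed (use PiE invol in auto)
qed

section \<open>Admissible fields and the real inequalities for one edge\<close>

locale nonpos_interaction =
  fixes V :: "'v set" and \<beta> g q :: real
  assumes finite_V: "finite V" and g_nonneg: "g \<ge> 0" and beta_ge: "\<beta> \<ge> 1 + g"
  defines "q \<equiv> g / (1 + g)"
begin

abbreviation Z :: "'v uprod multiset \<Rightarrow> ('v \<Rightarrow> nat \<Rightarrow> real) \<Rightarrow> real" where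
  "Z \<equiv> field_partition_function \<beta> (- g) V"

definition admissible :: "(nat \<Rightarrow> real) \<Rightarrow> bool" where
  "admissible p \<longleftrightarrow> p 0 > 0 \<and> - q * p 0 \<le> p 1 \<and> p 1 \<le> p 0"

text \<open>The ratio bounds are cross-multiplied and kept separate from positivity, because the
  bounds for a graph are established first and then used to prove its positivity. The field at
  \<open>r\<close> itself is overwritten.\<close>

definition root_bounded :: "'v uprod multiset \<Rightarrow> 'v \<Rightarrow> bool" where
  "root_bounded E r \<longleftrightarrow> (\<forall>f. (\<forall>v\<in>V. admissible (f v)) \<longrightarrow>
     Z E (f(r := pin 1)) \<le> Z E (f(r := pin 0)) \<and> - q * Z E (f(r := pin 0)) \<le> Z E (f(r := pin 1)))"

definition field_positive :: "'v uprod multiset \<Rightarrow> bool" where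
  "field_positive E \<longleftrightarrow> (\<forall>f. (\<forall>v\<in>V. admissible (f v)) \<longrightarrow> Z E f > 0)"

lemma q_bounds: "0 \<le> q" "q < 1" and q_mult: "q * (1 + g) = g"
  using g_nonneg by (auto simp: q_def field_simps)

lemma admissible_pin_0: "admissible (pin 0)"
  using q_bounds by (simp add: admissible_def)

lemma admissible_one: "admissible (\<lambda>_. 1)"
  using q_bounds by (simp add: admissible_def)

lemma admissible_loop: "admissible (\<lambda>i. if i = 0 then 1 else - q)"
  using q_bounds by (simp add: admissible_def)

text \<open>The ratios \<open>p 1 / p 0\<close> and \<open>z1 / z0\<close> both lie in
  \<open>[-q, 1]\<close>, so their product is at least \<open>-q\<close>, which exceeds -1.\<close>

lemma positive_of_root_bounds:
  assumes "admissible p" "z0 > 0" "z1 \<le> z0" "- q * z0 \<le> z1"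
  shows "p 0 * z0 + p 1 * z1 > 0"
proof (cases "p 1 \<ge> 0")
  case True
  have "p 1 * (- q * z0) \<le> p 1 * z1" using assms True by (intro mult_left_mono) auto
  moreover have "p 1 * (q * z0) \<le> p 0 * (q * z0)"
    using assms q_bounds by (intro mult_right_mono) (auto simp: admissible_def)
  moreover have "q * (p 0 * z0) < 1 * (p 0 * z0)"
    using assms q_bounds by (intro mult_strict_right_mono) (auto simp: admissible_def)
  ultimately show ?thesis by (simp add: algebra_simps)
next
  case False
  have "p 1 * z0 \<le> p 1 * z1" using assms False by (intro mult_left_mono_neg) auto
  moreover have "- q * p 0 * z0 \<le> p 1 * z0"
    using assms by (intro mult_right_mono) (auto simp: admissible_def)
  moreover have "q * (p 0 * z0) < 1 * (p 0 * z0)"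
    using assms q_bounds by (intro mult_strict_right_mono) (auto simp: admissible_def)
  ultimately show ?thesis by (simp add: algebra_simps)
qed

text \<open>Here \<open>nst\<close> is the partition function without the edge, its ends (root first) pinned
  to \<open>s\<close> and \<open>t\<close>, times the field weight of the second end at \<open>t\<close>.\<close>

lemma edge_step_upper:
  assumes "n00 > 0"
    and "0 \<le> q * (n00 + n10) + (n01 + n11)"
    and "n10 + n11 \<le> n00 + n01"
    and "n10 - q * n11 \<le> n00 - q * n01"
  shows "n10 - g * n11 \<le> \<beta> * n00 + n01"
proof -
  \<comment> \<open>The weights 1/2 and \<open>(1 + g) / 2\<close> match all four coefficients of
    the goal at \<open>\<beta> = 1 + g\<close>; the last summand is the slack for larger
    \<open>\<beta>\<close>.\<close>
  have "0 \<le> (1 + g) / 2 * (q * (n00 + n10) + (n01 + n11)) + 1 / 2 * (n00 + n01 - (n10 + n11))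
      + (1 + g) / 2 * (n00 - q * n01 - (n10 - q * n11)) + (\<beta> - (1 + g)) * n00"
    using assms g_nonneg beta_ge
    by (intro add_nonneg_nonneg[OF add_nonneg_nonneg[OF add_nonneg_nonneg]] mult_nonneg_nonneg) auto
  also have "\<dots> = (q * (1 + g)) / 2 * (n00 + n10) + (1 + g) / 2 * (n01 + n11)
      + 1 / 2 * (n00 + n01 - (n10 + n11)) + (1 + g) / 2 * (n00 - n10)
      - (q * (1 + g)) / 2 * (n01 - n11) + (\<beta> - (1 + g)) * n00"
    by (simp add: field_simps)
  also have "\<dots> = \<beta> * n00 + n01 - (n10 - g * n11)"
    unfolding q_mult by (simp add: field_simps)
  finally show ?thesis by simp
qed

text \<open>The hypotheses are the lower root inequalities at the two ends, each tensored with the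
  loop field \<open>(1, -q)\<close> at the other end.\<close>

lemma edge_step_lower:
  assumes "n00 > 0"
    and "0 \<le> q * (n00 - q * n01) + (n10 - q * n11)"
    and "0 \<le> q * (n00 - q * n10) + (n01 - q * n11)"
  shows "- q * (\<beta> * n00 + n01) \<le> n10 - g * n11"
proof -
  \<comment> \<open>Matching coefficients in \<open>a\<close> times the first hypothesis plus
    \<open>d\<close> times the second requires \<open>a + d = 1 + g\<close>,
    \<open>a - q\<^sup>2 * d = 1\<close> and \<open>d - q\<^sup>2 * a = q\<close>. These three
    equations are compatible because \<open>q * (1 + g) = g\<close>.\<close>
  define a where "a = (1 + g * q) / (1 + q\<^sup>2)"
  define d where "d = q + q\<^sup>2 * a"
  have pos: "1 + q\<^sup>2 > 0" by (simp add: add_pos_nonneg)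
  have a_mult: "a * (1 + q\<^sup>2) = 1 + g * q" using pos by (simp add: a_def)
  have "a \<ge> 0" "d \<ge> 0" using q_bounds g_nonneg by (auto simp: a_def d_def)
  have "a + d = a * (1 + q\<^sup>2) + q" by (simp add: d_def algebra_simps)
  also have "\<dots> = 1 + q * (1 + g)" unfolding a_mult by (simp add: algebra_simps)
  finally have sum: "a + d = 1 + g" unfolding q_mult .
  have "a - q\<^sup>2 * d = (a * (1 + q\<^sup>2)) * (1 - q\<^sup>2) - q ^ 3"
    by (simp add: d_def algebra_simps power2_eq_square power3_eq_cube)
  also have "\<dots> = 1 + q * (g - q * (1 + g)) + q\<^sup>2 * (g - q * (1 + g))"
    unfolding a_mult by (simp add: algebra_simps power2_eq_square power3_eq_cube)
  finally have diff: "a - q\<^sup>2 * d = 1" unfolding q_mult by simp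
  have "0 \<le> a * (q * (n00 - q * n01) + (n10 - q * n11)) + d * (q * (n00 - q * n10) + (n01 - q * n11))
      + q * ((\<beta> - (1 + g)) * n00)"
    using assms \<open>a \<ge> 0\<close> \<open>d \<ge> 0\<close> q_bounds beta_ge
    by (intro add_nonneg_nonneg[OF add_nonneg_nonneg] mult_nonneg_nonneg) auto
  also have "\<dots> = q * (a + d) * (n00 - n11) + (a - q\<^sup>2 * d) * n10 + (d - q\<^sup>2 * a) * n01
      + q * \<beta> * n00 - q * (1 + g) * n00"
    by (simp add: algebra_simps power2_eq_square)
  also have "d - q\<^sup>2 * a = q" by (simp add: d_def)
  finally show ?thesis unfolding diff sum q_mult by (simp add: algebra_simps)
qed

section \<open>Adding one edge to a graph that satisfies the invariant\<close>

text \<open>The root bounds say nothing about the sign of the sum until the part with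
  \<open>u\<close> pinned to 0 is known to be positive; that part reduces to the graph without the
  edge.\<close>

lemma field_positive_of_root_bounded:
  assumes "\<And>r. r \<in> set_uprod e \<Longrightarrow> root_bounded (add_mset e E) r" "field_positive E" "set_uprod e \<subseteq> V"
  shows "field_positive (add_mset e E)"
  unfolding field_positive_def
proof (intro allI impI)
  fix f :: "'v \<Rightarrow> nat \<Rightarrow> real" assume f: "\<forall>v\<in>V. admissible (f v)"
  obtain u w where e: "e = Upair u w" by (cases e)
  have V: "u \<in> V" "w \<in> V" using assms(3) e by auto
  let ?E = "add_mset e E"
  have pinned: "Z ?E (f(u := pin 0)) > 0"
  proof (cases "u = w")
    case True
    have "Z E (f(u := pin 0)) > 0"
      using assms(2) f admissible_pin_0 by (auto simp: field_positive_def)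
    then show ?thesis
      using True V beta_ge g_nonneg e
      by (simp add: field_partition_function_pinned_edge[OF finite_V, where s = 0 and t = 0]
          interaction_def)
  next
    case False
    \<comment> \<open>With \<open>u\<close> at spin 0 the edge only multiplies the field at
      \<open>w\<close> by \<open>(\<beta>, 1)\<close>, which preserves admissibility since
      \<open>\<beta> \<ge> 1\<close>.\<close>
    let ?p = "\<lambda>i. if i = 0 then \<beta> * f w 0 else f w 1"
    have "admissible (f w)" using f V by auto
    then have fw: "f w 0 > 0" "- q * f w 0 \<le> f w 1" "f w 1 \<le> f w 0" by (auto simp: admissible_def)
    have "1 * f w 0 \<le> \<beta> * f w 0" "q * (1 * f w 0) \<le> q * (\<beta> * f w 0)"
      using fw beta_ge g_nonneg q_bounds by (auto intro!: mult_left_mono mult_right_mono)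
    moreover from this(1) have "f w 1 \<le> \<beta> * f w 0" using fw by linarith
    ultimately have "admissible ?p" using fw beta_ge g_nonneg by (auto simp: admissible_def)
    then have "Z E (f(u := pin 0, w := ?p)) > 0"
      using assms(2) f admissible_pin_0 by (auto simp: field_positive_def)
    also have "Z E (f(u := pin 0, w := ?p)) = Z ?E (f(u := pin 0, w := f w))"
      using V False
        field_partition_function_linear[OF finite_V V(2), of \<beta> "- g" E "f(u := pin 0)" ?p]
        field_partition_function_linear[OF finite_V V(2), of \<beta> "- g" ?E "f(u := pin 0)" "f w"]
      by (simp add: e field_partition_function_pinned_edge[OF finite_V, where s = 0 and t = 0]
          field_partition_function_pinned_edge[OF finite_V, where s = 0 and t = 1] interaction_def)
    also have "f(u := pin 0, w := f w) = f(u := pin 0)" using False by auto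
    finally show ?thesis .
  qed
  have "f u 0 * Z ?E (f(u := pin 0)) + f u 1 * Z ?E (f(u := pin 1)) > 0"
    using assms(1)[of u] e f V pinned by (intro positive_of_root_bounds) (auto simp: root_bounded_def)
  then have "Z ?E (f(u := f u)) > 0"
    by (simp only: field_partition_function_linear[OF finite_V V(1), of \<beta> "- g" ?E f "f u"])
  then show "Z ?E f > 0" by simp
qed

text \<open>A loop multiplies the root ratio by \<open>-g / \<beta>\<close>. The result stays in
  \<open>[-q, 1]\<close> because \<open>g / \<beta> \<le> q\<close> and
  \<open>q < 1\<close>.\<close>

lemma root_bounds_add_loop:
  assumes "root_bounded E r" "field_positive E" "r \<in> V" "\<forall>v\<in>V. admissible (f v)"
  shows "Z (add_mset (Upair r r) E) (f(r := pin 1)) \<le> Z (add_mset (Upair r r) E) (f(r := pin 0))"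
    and "- q * Z (add_mset (Upair r r) E) (f(r := pin 0)) \<le> Z (add_mset (Upair r r) E) (f(r := pin 1))"
proof -
  define z0 z1 where "z0 = Z E (f(r := pin 0))" and "z1 = Z E (f(r := pin 1))"
  have z0: "z0 > 0"
    using assms admissible_pin_0 by (auto simp: field_positive_def z0_def)
  have z1: "z1 \<le> z0" "- q * z0 \<le> z1"
    using assms by (auto simp: root_bounded_def z0_def z1_def)
  have eq: "Z (add_mset (Upair r r) E) (f(r := pin 0)) = \<beta> * z0"
    "Z (add_mset (Upair r r) E) (f(r := pin 1)) = - g * z1"
    using assms(3)
    by (simp_all add: field_partition_function_pinned_edge[OF finite_V, where s = 0 and t = 0]
        field_partition_function_pinned_edge[OF finite_V, where s = 1 and t = 1]
        interaction_def z0_def z1_def)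
  have 1: "g * z1 \<le> g * z0" "g * (- q * z0) \<le> g * z1"
    by (rule mult_left_mono[OF z1(1) g_nonneg], rule mult_left_mono[OF z1(2) g_nonneg])
  have 2: "(1 + g) * z0 \<le> \<beta> * z0" using beta_ge z0 by (intro mult_right_mono) auto
  have 3: "g * (q * z0) \<le> g * (1 * z0)"
    using q_bounds g_nonneg z0 by (intro mult_left_mono mult_right_mono) auto
  show "Z (add_mset (Upair r r) E) (f(r := pin 1)) \<le> Z (add_mset (Upair r r) E) (f(r := pin 0))"
    unfolding eq using 1 2 3 z0 by (simp add: algebra_simps)
  have "g * z0 = q * ((1 + g) * z0)" using q_mult by (simp add: mult.assoc[symmetric])
  also have "\<dots> \<le> q * (\<beta> * z0)" using 2 q_bounds by (intro mult_left_mono)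
  finally show "- q * Z (add_mset (Upair r r) E) (f(r := pin 0)) \<le> Z (add_mset (Upair r r) E) (f(r := pin 1))"
    unfolding eq using 1 by simp
qed

text \<open>Without the edge, the bounds at \<open>r\<close> and at \<open>w\<close> are available
  for every admissible field at the opposite end; four choices of that field supply the hypotheses
  of \<open>edge_step_upper\<close> and \<open>edge_step_lower\<close>.\<close>

lemma root_bounds_add_edge:
  assumes "\<And>v. v \<in> V \<Longrightarrow> root_bounded E v" "field_positive E"
    and "r \<in> V" "w \<in> V" "r \<noteq> w" "\<forall>v\<in>V. admissible (f v)"
  shows "Z (add_mset (Upair r w) E) (f(r := pin 1)) \<le> Z (add_mset (Upair r w) E) (f(r := pin 0))"
    and "- q * Z (add_mset (Upair r w) E) (f(r := pin 0)) \<le> Z (add_mset (Upair r w) E) (f(r := pin 1))"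
proof -
  define p where "p = f w"
  define N where "N s t = Z E (f(r := pin s, w := pin t))" for s t
  define n where "n s t = p t * N s t" for s t
  \<comment> \<open>The product of \<open>p\<close> with the loop field \<open>(1, -q)\<close>; it
    is admissible because \<open>[-q, 1]\<close> is closed under multiplication.\<close>
  let ?p' = "\<lambda>i::nat. if i = 0 then p 0 else - q * p 1"
  have p: "admissible p" using assms by (simp add: p_def)
  then have p_bounds: "p 0 > 0" "- q * p 0 \<le> p 1" "p 1 \<le> p 0" by (auto simp: admissible_def)
  have "q * p 1 \<le> q * p 0" "q * (- q * p 0) \<le> q * p 1"
    by (rule mult_left_mono[OF p_bounds(3) q_bounds(1)], rule mult_left_mono[OF p_bounds(2) q_bounds(1)])
  moreover have "q * (q * p 0) \<le> p 0"
    using p_bounds q_bounds by (simp add: mult_le_one mult.assoc[symmetric])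
  ultimately have "- q * p 0 \<le> - q * p 1" "- q * p 1 \<le> p 0"
    by (simp_all only: mult_minus_left mult_minus_right)
  then have p': "admissible ?p'" using p_bounds by (simp add: admissible_def)
  note bilinear = field_partition_function_bilinear[OF finite_V assms(3,4,5)]
  \<comment> \<open>The lower root inequality at \<open>w\<close>, with the field \<open>p\<close>
    put back: a product of two ratios in \<open>[-q, 1]\<close> is at least
    \<open>-q\<close>.\<close>
  have at_w: "0 \<le> q * p 0 * (x 0 * N 0 0 + x 1 * N 1 0) + p 1 * (x 0 * N 0 1 + x 1 * N 1 1)"
    if "admissible x" for x
  proof -
    define z0 z1 where "z0 = Z E (f(r := x, w := pin 0))" and "z1 = Z E (f(r := x, w := pin 1))"
    have adm: "\<forall>v\<in>V. admissible ((f(r := x)) v)" using assms(6) that by auto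
    then have z: "z1 \<le> z0" "- q * z0 \<le> z1"
      using assms(1)[OF assms(4)] by (auto simp: root_bounded_def z0_def z1_def)
    have z0: "z0 > 0"
      using assms(2) adm admissible_pin_0 by (auto simp: field_positive_def z0_def)
    have eq: "z0 = x 0 * N 0 0 + x 1 * N 1 0" "z1 = x 0 * N 0 1 + x 1 * N 1 1"
      unfolding z0_def z1_def N_def
      using bilinear[of \<beta> "- g" E f x "pin 0"] bilinear[of \<beta> "- g" E f x "pin 1"] by simp_all
    have "0 \<le> q * p 0 * z0 + p 1 * z1"
    proof (cases "p 1 \<ge> 0")
      case True
      have "p 1 * (- q * z0) \<le> p 1 * z1" using z True by (intro mult_left_mono)
      moreover have "p 1 * (q * z0) \<le> p 0 * (q * z0)"
        using p_bounds q_bounds z0 by (intro mult_right_mono) auto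
      ultimately show ?thesis by (simp add: algebra_simps)
    next
      case False
      have "p 1 * z0 \<le> p 1 * z1" using z False by (intro mult_left_mono_neg) auto
      moreover have "- q * p 0 * z0 \<le> p 1 * z0" using p_bounds z0 by (intro mult_right_mono) auto
      ultimately show ?thesis by (simp add: algebra_simps)
    qed
    then show ?thesis by (simp add: eq)
  qed
  have at_r: "y 0 * N 1 0 + y 1 * N 1 1 \<le> y 0 * N 0 0 + y 1 * N 0 1"
    "- q * (y 0 * N 0 0 + y 1 * N 0 1) \<le> y 0 * N 1 0 + y 1 * N 1 1" if "admissible y" for y
  proof -
    have adm: "\<forall>v\<in>V. admissible ((f(w := y)) v)" using assms(6) that by auto
    have twist: "f(w := y, r := z) = f(r := z, w := y)" for z
      using assms(5) by (simp add: fun_upd_twist)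
    have "Z E (f(r := pin 1, w := y)) \<le> Z E (f(r := pin 0, w := y))"
      "- q * Z E (f(r := pin 0, w := y)) \<le> Z E (f(r := pin 1, w := y))"
      using assms(1)[OF assms(3)] adm unfolding root_bounded_def twist[symmetric] by blast+
    then show "y 0 * N 1 0 + y 1 * N 1 1 \<le> y 0 * N 0 0 + y 1 * N 0 1"
      "- q * (y 0 * N 0 0 + y 1 * N 0 1) \<le> y 0 * N 1 0 + y 1 * N 1 1"
      unfolding N_def
      using bilinear[of \<beta> "- g" E f "pin 0" y] bilinear[of \<beta> "- g" E f "pin 1" y] by simp_all
  qed
  have "N 0 0 > 0"
    using assms(2,6) admissible_pin_0 by (auto simp: field_positive_def N_def)
  then have n00: "n 0 0 > 0" using p_bounds by (simp add: n_def)
  have pinned: "Z (add_mset (Upair r w) E) (f(r := pin s)) =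
      interaction \<beta> (- g) s 0 * n s 0 + interaction \<beta> (- g) s 1 * n s 1" for s
  proof -
    have f: "f(r := pin s) = f(r := pin s, w := p)" using assms(5) by (auto simp: p_def)
    have "Z (add_mset (Upair r w) E) (f(r := pin s, w := p)) =
        p 0 * Z (add_mset (Upair r w) E) (f(r := pin s, w := pin 0)) +
        p 1 * Z (add_mset (Upair r w) E) (f(r := pin s, w := pin 1))"
      by (rule field_partition_function_linear[OF finite_V assms(4)])
    also have "\<dots> = interaction \<beta> (- g) s 0 * n s 0 + interaction \<beta> (- g) s 1 * n s 1"
      using assms(3-5)
      by (simp add: field_partition_function_pinned_edge[OF finite_V, where s = s and t = 0]
          field_partition_function_pinned_edge[OF finite_V, where s = s and t = 1] n_def N_def)
    finally show ?thesis unfolding f[symmetric] .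
  qed
  have "n 1 0 - g * n 1 1 \<le> \<beta> * n 0 0 + n 0 1"
  proof (rule edge_step_upper[OF n00])
    show "0 \<le> q * (n 0 0 + n 1 0) + (n 0 1 + n 1 1)"
      using at_w[OF admissible_one] by (simp add: n_def algebra_simps)
    show "n 1 0 + n 1 1 \<le> n 0 0 + n 0 1"
      using at_r(1)[OF p] by (simp add: n_def)
    show "n 1 0 - q * n 1 1 \<le> n 0 0 - q * n 0 1"
      using at_r(1)[OF p'] by (simp add: n_def mult.assoc)
  qed
  then show "Z (add_mset (Upair r w) E) (f(r := pin 1)) \<le> Z (add_mset (Upair r w) E) (f(r := pin 0))"
    unfolding pinned by (simp add: interaction_def)
  have "- q * (\<beta> * n 0 0 + n 0 1) \<le> n 1 0 - g * n 1 1"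
  proof (rule edge_step_lower[OF n00])
    show "0 \<le> q * (n 0 0 - q * n 0 1) + (n 1 0 - q * n 1 1)"
      using at_r(2)[OF p'] by (simp add: n_def mult.assoc)
    show "0 \<le> q * (n 0 0 - q * n 1 0) + (n 0 1 - q * n 1 1)"
      using at_w[OF admissible_loop] by (simp add: n_def algebra_simps)
  qed
  then show "- q * Z (add_mset (Upair r w) E) (f(r := pin 0)) \<le> Z (add_mset (Upair r w) E) (f(r := pin 1))"
    unfolding pinned by (simp add: interaction_def)
qed

section \<open>Induction on the number of edges\<close>

text \<open>Induction on size leaves the deleted edge free, so it can be chosen at the root in
  question. Each step proves the bounds at non-isolated roots, then positivity, then the bounds at
  isolated roots, which rely on positivity.\<close>

lemma root_bounded_and_field_positive:
  assumes "multigraph V E"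
  shows "(\<forall>r\<in>V. root_bounded E r) \<and> field_positive E"
  using assms
proof (induction E rule: measure_induct_rule[where f = size])
  case (less E)
  have IH: "(\<forall>r\<in>V. root_bounded E' r) \<and> field_positive E'" if "E = add_mset e E'" for e E'
    using less that by (auto simp: multigraph_def)
  have incident: "root_bounded E r" if e: "e \<in># E" "r \<in> set_uprod e" for e r
  proof -
    obtain E' where E: "E = add_mset e E'" using e(1) by (blast dest: multi_member_split)
    obtain w where w: "e = Upair r w"
      using e(2) by (cases e) auto
    have "r \<in> V" "w \<in> V" using less.prems e(1) w by (auto simp: multigraph_def)
    then show ?thesis
      using root_bounds_add_loop[of E' r] root_bounds_add_edge[of E' r w] IH[OF E]
      by (cases "r = w") (auto simp: E w root_bounded_def)
  qed
  have pos: "field_positive E"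
  proof (cases E)
    case empty
    have "p 0 + p 1 > 0" if "admissible p" for p
      using positive_of_root_bounds[OF that, of 1 1] q_bounds by simp
    then show ?thesis
      by (auto simp: empty field_positive_def field_partition_function_empty[OF finite_V]
          intro!: prod_pos)
  next
    case (add e E')
    have "set_uprod e \<subseteq> V" using less.prems add by (auto simp: multigraph_def)
    then show ?thesis
      unfolding add
      using incident[of e] IH[OF add] by (intro field_positive_of_root_bounded) (auto simp: add)
  qed
  have "root_bounded E r" if r: "r \<in> V" for r
  proof (cases "\<exists>e\<in>#E. r \<in> set_uprod e")
    case False
    have "Z E (f(r := pin 1)) = Z E (f(r := pin 0))" for f
      using False r by (intro field_partition_function_isolated[OF finite_V]) auto
    moreover have "Z E (f(r := pin 0)) > 0" if "\<forall>v\<in>V. admissible (f v)" for f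
      using pos that admissible_pin_0 by (auto simp: field_positive_def)
    moreover have "- q * z \<le> z" if "z > 0" for z
      using mult_nonneg_nonneg[of q z] q_bounds that by linarith
    ultimately show ?thesis by (auto simp: root_bounded_def)
  qed (use incident in auto)
  with pos show ?case by blast
qed

lemma partition_function_pos:
  assumes "multigraph V E"
  shows "partition_function \<beta> (- g) V E > 0"
  using root_bounded_and_field_positive[OF assms] admissible_one
  by (auto simp: field_positive_def partition_function_eq_field)

end

section \<open>Cases by the signs of the diagonal entries\<close>

lemma partition_function_pos_of_nonpos:
  assumes "\<beta> + \<gamma> \<ge> 1" "\<gamma> \<le> 0" "multigraph V E"
  shows "partition_function \<beta> \<gamma> V E > 0"
proof -
  interpret nonpos_interaction V \<beta> "- \<gamma>" "- \<gamma> / (1 + - \<gamma>)"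
    using assms by unfold_locales (auto simp: multigraph_def)
  show ?thesis using partition_function_pos[OF assms(3)] by simp
qed

lemma partition_function_pos_of_pos:
  assumes "\<beta> > 0" "\<gamma> > 0" "multigraph V E"
  shows "partition_function \<beta> \<gamma> V E > 0"
proof -
  have "edge_weight \<beta> \<gamma> e > 0" for e
    using assms by (cases e) (auto simp: interaction_def)
  then have "(\<Prod>e \<in># F. edge_weight \<beta> \<gamma> (map_uprod \<sigma> e)) > 0" for F and \<sigma> :: "'a \<Rightarrow> nat"
    by (induction F) auto
  then show ?thesis
    using assms(3) unfolding partition_function_def
    by (intro sum_pos) (auto simp: multigraph_def finite_PiE PiE_eq_empty_iff)
qed

theorem theorem4:
  fixes \<beta> \<gamma> :: real and V :: "'v set" and E :: "'v uprod multiset"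
  assumes "\<beta> + \<gamma> \<ge> 1"
    and "multigraph V E"
  shows "partition_function \<beta> \<gamma> V E > 0"
proof -
  consider "\<gamma> \<le> 0" | "\<beta> \<le> 0" | "\<beta> > 0" "\<gamma> > 0" by linarith
  then show ?thesis
  proof cases
    case 1
    then show ?thesis using partition_function_pos_of_nonpos assms by blast
  next
    case 2
    then have "partition_function \<gamma> \<beta> V E > 0"
      using assms by (intro partition_function_pos_of_nonpos) auto
    then show ?thesis by (simp add: partition_function_swap[OF assms(2), of \<beta> \<gamma>])
  next
    case 3
    then show ?thesis using partition_function_pos_of_pos assms by blast
  qed
qed

end
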